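(* Let $m,n,q\ge 1$ be integers and let $G$ be a simple graph with at least one edge on the vertex set $\{v_{i,j,k} : 1\le i\le m,\ 1\le j\le n,\ 1\le k\le q\}$. Suppose that $G$ is partially symmetric and satisfies the following conditions. (1) There is no edge between two vertices of the same layer $C_i$: $(v_{i,j,k},v_{i,l,v})\notin E(G)$ for all $i,j,k,l,v$. (2) (a) For all $i\neq k$ and $j\neq l$ in $\{1,\dots,m\}$: if $A_{i,k}\neq 0$ and $A_{j,l}\ne 0$, then $A_{i,k}=A_{j,l}$. (That is, any two distinct layers $C_i,C_k$ either have no edge between them, or $A_{i,k}$ equals one common matrix.) (b) For all pairs $(i,j)\neq(k,l)$ and $(s,t)\neq(u,v)$ in $\{1,\dots,m\}\times\{1,\dots,n\}$: if $A_{ij,kl}\ne 0$ and $A_{st,uv}\neq 0$, then $A_{ij,kl}=A_{st,uv}$. (That is, any two distinct sublayers $C_{i,j},C_{k,l}$ either have no edge between them, or $A_{ij,kl}$ equals one common matrix.) (3) For each $i\in\{1,\dots,m\}$, all vertices in the layer $C_i$ have the same degree. Then $\rho_q(G)$ is fully separable in $\mathbb{C}^m\otimes\mathbb{C}^n\otimes\mathbb{C}^q$.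
   Context: Graphs are finite, undirected and simple (no loops, no multiple edges); an edge $(a,b)$ is the same as $(b,a)$. $D(G)$ is the diagonal degree matrix and $A(G)$ is the $0/1$ adjacency matrix. Put $Q(G)=D(G)+A(G)$ and define (for $G$ with at least one edge) $$\rho_q(G)=\frac{Q(G)}{\mathrm{tr}(Q(G))}.$$ The vertex $v_{i,j,k}$ is identified with the integer $nq(i-1)+q(j-1)+k\in\{1,\dots,mnq\}$, so that the matrices above act on $\mathbb{C}^m\otimes\mathbb{C}^n\otimes\mathbb{C}^q$, with $v_{i,j,k}$ corresponding to the basis vector $e_i\otimes e_j\otimes e_k$. Layers: $C_i=\{v_{i,j,k}: 1\le j\le n,\ 1\le k\le q\}$ for $1\le i\le m$, and sublayers $C_{i,j}=\{v_{i,j,k}:1\le k\le q\}$ for $1\le i\le m$, $1\le j\le n$. $A_{i,k}$ denotes the $nq\times nq$ block of $A(G)$ with rows indexed by $C_i$ and columns indexed by $C_k$ (vertices ordered by their integer labels), and $A_{ij,kl}$ denotes the $q\times q$ block of $A(G)$ with rows indexed by $C_{i,j}$ and columns indexed by $C_{k,l}$. Blocks are compared entrywise via these orderings. $G$ is partially symmetric if for all $i\ne s$ and all $j,k,u,v$: $(v_{i,j,k},v_{s,u,v})\in E(G)$ implies $(v_{s,j,k},v_{i,u,v})\in E(G)$. A density matrix is a positive semidefinite Hermitian matrix of trace $1$. A density matrix $\rho$ on $H_1\otimes H_2\otimes H_3$ is fully separable if $\rho=\sum_i p_i\,\rho_i^1\otimes\rho_i^2\otimes\rho_i^3$ (finite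 sum) with $p_i\ge 0$, $\sum_i p_i=1$, and each $\rho_i^j$ a density matrix on $H_j$. *)

theory Defs
  imports
    "Jordan_Normal_Form.Schur_Decomposition"
    "Jordan_Normal_Form.DL_Submatrix"
    "Graph_Theory.Pair_Digraph"
begin

text \<open>
  Finite simple graphs are rendered by the locale \<open>pair_graph\<close>: an undirected edge is the
  pair of arcs \<open>(a, b)\<close>, \<open>(b, a)\<close> in \<open>parcs G\<close>, so \<open>out_degree\<close> counts the neighbours of a vertex.
  Vertices are the labels \<open>1, \<dots>, N\<close>, while matrix indices start at 0: the vertex \<open>v\<close> belongs to
  the row and column \<open>v - 1\<close>.
\<close>

subsection \<open>Matrices of a graph on the vertices \<open>1, \<dots>, N\<close>\<close>

definition adjacency_mat :: "nat pair_pre_digraph \<Rightarrow> complex mat" where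
  "adjacency_mat G = mat (card (pverts G)) (card (pverts G))
     (\<lambda>(a, b). if (a + 1, b + 1) \<in> parcs G then 1 else 0)"

definition degree_mat :: "nat pair_pre_digraph \<Rightarrow> complex mat" where
  "degree_mat G = mat_diag (card (pverts G)) (\<lambda>a. of_nat (out_degree (with_proj G) (a + 1)))"

definition signless_laplacian :: "nat pair_pre_digraph \<Rightarrow> complex mat" where
  "signless_laplacian G = degree_mat G + adjacency_mat G"

definition mat_trace :: "'a :: comm_monoid_add mat \<Rightarrow> 'a" where
  "mat_trace A = (\<Sum>i<dim_row A. A $$ (i, i))"

definition rho_q :: "nat pair_pre_digraph \<Rightarrow> complex mat" where
  "rho_q G = (1 / mat_trace (signless_laplacian G)) \<cdot>\<^sub>m signless_laplacian G"

subsection \<open>Layers and blocks\<close>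

definition vtx :: "nat \<Rightarrow> nat \<Rightarrow> nat \<Rightarrow> nat \<Rightarrow> nat \<Rightarrow> nat" where
  "vtx n q i j k = n * q * (i - 1) + q * (j - 1) + k"

definition layer :: "nat \<Rightarrow> nat \<Rightarrow> nat \<Rightarrow> nat set" where
  "layer n q i = {vtx n q i j k | j k. j \<in> {1..n} \<and> k \<in> {1..q}}"

definition sublayer :: "nat \<Rightarrow> nat \<Rightarrow> nat \<Rightarrow> nat \<Rightarrow> nat set" where
  "sublayer n q i j = {vtx n q i j k | k. k \<in> {1..q}}"

text \<open>\<open>submatrix\<close> lists the selected rows and columns in increasing order.\<close>

definition adjacency_block :: "nat pair_pre_digraph \<Rightarrow> nat set \<Rightarrow> nat set \<Rightarrow> complex mat" where
  "adjacency_block G V W =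
     submatrix (adjacency_mat G) ((\<lambda>v. v - 1) ` V) ((\<lambda>w. w - 1) ` W)"

definition partially_symmetric :: "nat \<Rightarrow> nat \<Rightarrow> nat \<Rightarrow> nat pair_pre_digraph \<Rightarrow> bool" where
  "partially_symmetric m n q G \<longleftrightarrow>
     (\<forall>i\<in>{1..m}. \<forall>s\<in>{1..m}. \<forall>j\<in>{1..n}. \<forall>u\<in>{1..n}. \<forall>k\<in>{1..q}. \<forall>v\<in>{1..q}.
        i \<noteq> s \<longrightarrow> (vtx n q i j k, vtx n q s u v) \<in> parcs G
              \<longrightarrow> (vtx n q s j k, vtx n q i u v) \<in> parcs G)"

subsection \<open>Density matrices and full separability\<close>

text \<open>
  The scalar product \<open>v \<bullet>c w\<close> conjugates \<open>w\<close>, and \<open>0 \<le> z\<close> on complex numbers says that \<open>z\<close> is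
  real and non-negative.
\<close>

definition density_matrix :: "nat \<Rightarrow> complex mat \<Rightarrow> bool" where
  "density_matrix d \<rho> \<longleftrightarrow>
     \<rho> \<in> carrier_mat d d \<and> mat_adjoint \<rho> = \<rho> \<and>
     (\<forall>x\<in>carrier_vec d. 0 \<le> (\<rho> *\<^sub>v x) \<bullet>c x) \<and>
     mat_trace \<rho> = 1"

text \<open>
  Kronecker product; with the basis of the iterated product enumerated by \<open>vtx n q i j k - 1\<close>,
  this is the tensor product of operators.
\<close>

definition kronecker :: "'a :: times mat \<Rightarrow> 'a mat \<Rightarrow> 'a mat" (infixl \<open>\<otimes>\<^sub>K\<close> 72) where
  "A \<otimes>\<^sub>K B = mat (dim_row A * dim_row B) (dim_col A * dim_col B)
     (\<lambda>(a, b). A $$ (a div dim_row B, b div dim_col B) * B $$ (a mod dim_row B, b mod dim_col B))"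

definition fully_separable :: "nat \<Rightarrow> nat \<Rightarrow> nat \<Rightarrow> complex mat \<Rightarrow> bool" where
  "fully_separable m n q \<rho> \<longleftrightarrow>
     density_matrix (m * n * q) \<rho> \<and>
     (\<exists>(r :: nat) (p :: nat \<Rightarrow> real) \<rho>1 \<rho>2 \<rho>3.
        (\<forall>i<r. 0 \<le> p i) \<and> (\<Sum>i<r. p i) = 1 \<and>
        (\<forall>i<r. density_matrix m (\<rho>1 i) \<and> density_matrix n (\<rho>2 i) \<and> density_matrix q (\<rho>3 i)) \<and>
        \<rho> = mat (m * n * q) (m * n * q)
              (\<lambda>ab. \<Sum>i<r. complex_of_real (p i) * (\<rho>1 i \<otimes>\<^sub>K \<rho>2 i \<otimes>\<^sub>K \<rho>3 i) $$ ab))"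

end

theory Submission
  imports Defs
begin

text \<open>
  The sublayer condition factors the adjacency matrix as \<open>P \<otimes> C\<close>, and the layer condition factors
  \<open>P\<close> further, so that \<open>A = M \<otimes> N \<otimes> C\<close> with symmetric 0/1 matrices. Row sums are multiplicative,
  hence \<open>Q = D\<^sub>M \<otimes> D\<^sub>N \<otimes> D\<^sub>C + M \<otimes> N \<otimes> C\<close> with diagonal matrices of row sums. This is a quarter of
  the sum of \<open>(D\<^sub>M + s\<^sub>1 M) \<otimes> (D\<^sub>N + s\<^sub>2 N) \<otimes> (D\<^sub>C + s\<^sub>3 C)\<close> over the four sign patterns with
  \<open>s\<^sub>1 s\<^sub>2 s\<^sub>3 = 1\<close>, the mixed terms cancelling, and each factor is positive semidefinite by
  diagonal dominance.
\<close>

section \<open>Signed Laplacians\<close>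

text \<open>For symmetric weights, \<open>s = 1\<close> gives the signless Laplacian of a weighted
  graph and \<open>s = -1\<close> the ordinary Laplacian. Loops are allowed: a loop of weight
  \<open>f a a\<close> contributes \<open>(1 + s) * f a a\<close> to the diagonal. Tensor factors of
  a loopless graph may well have loops.\<close>

definition signed_laplacian :: "nat \<Rightarrow> real \<Rightarrow> (nat \<Rightarrow> nat \<Rightarrow> real) \<Rightarrow> complex mat" where
  "signed_laplacian d s f =
     mat d d (\<lambda>(a, b). of_real ((if a = b then \<Sum>c<d. f a c else 0) + s * f a b))"

text \<open>Kept as a real number, so that signs and divisions are handled over the reals.\<close>

definition signed_laplacian_trace :: "nat \<Rightarrow> real \<Rightarrow> (nat \<Rightarrow> nat \<Rightarrow> real) \<Rightarrow> real" where
  "signed_laplacian_trace d s f = (\<Sum>a<d. \<Sum>b<d. f a b) + s * (\<Sum>a<d. f a a)"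

lemma mat_trace_signed_laplacian:
  "mat_trace (signed_laplacian d s f) = of_real (signed_laplacian_trace d s f)"
  by (simp add: mat_trace_def signed_laplacian_def signed_laplacian_trace_def
      sum.distrib sum_distrib_left)

lemma hermitian_matI:
  assumes "A \<in> carrier_mat d d"
    and "\<And>i j. i < d \<Longrightarrow> j < d \<Longrightarrow> conjugate (A $$ (j, i)) = A $$ (i, j)"
  shows "mat_adjoint A = A"
  using assms by (intro eq_matI) (auto simp: mat_adjoint_def mat_of_rows_index)

text \<open>Expand the square using \<open>s * s = 1\<close>. By symmetry of \<open>f\<close> the
  two square terms both sum to the degree part \<open>?X\<close> and the two cross terms both sum to
  \<open>?Y\<close>; this doubling explains the factor 1/2.\<close>

lemma signed_laplacian_quadratic_form:
  assumes sym: "\<And>a b. a < d \<Longrightarrow> b < d \<Longrightarrow> f a b = f b a"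
    and s: "s = 1 \<or> s = -1" and x: "x \<in> carrier_vec d"
  shows "(signed_laplacian d s f *\<^sub>v x) \<bullet>c x =
    of_real ((\<Sum>a<d. \<Sum>b<d. f a b * (cmod (x $ a + of_real s * x $ b))\<^sup>2) / 2)"
proof -
  let ?D = "\<lambda>a. \<Sum>c<d. f a c"
  let ?X = "\<Sum>a<d. \<Sum>b<d. of_real (f a b) * (x $ a * cnj (x $ a))"
  let ?Y = "\<Sum>a<d. \<Sum>b<d. of_real (f a b) * of_real s * (x $ b * cnj (x $ a))"
  have swap: "(\<Sum>a<d. \<Sum>b<d. of_real (f a b) * g b a) = (\<Sum>a<d. \<Sum>b<d. of_real (f a b) * g a b)"
    for g :: "nat \<Rightarrow> nat \<Rightarrow> complex"
    by (subst sum.swap) (intro sum.cong refl, simp add: sym)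
  have "(signed_laplacian d s f *\<^sub>v x) \<bullet>c x =
     (\<Sum>a<d. (\<Sum>b<d. of_real ((if a = b then ?D a else 0) + s * f a b) * x $ b) * cnj (x $ a))"
    using x by (simp add: signed_laplacian_def scalar_prod_def lessThan_atLeast0)
  also have "\<dots> = (\<Sum>a<d. of_real (?D a) * (x $ a * cnj (x $ a))) + ?Y"
  proof -
    have "(\<Sum>b<d. of_real ((if a = b then ?D a else 0) + s * f a b) * x $ b) * cnj (x $ a) =
        of_real (?D a) * (x $ a * cnj (x $ a)) +
        (\<Sum>b<d. of_real (f a b) * of_real s * (x $ b * cnj (x $ a)))" if "a < d" for a
    proof -
      have "(\<Sum>b<d. of_real ((if a = b then ?D a else 0) + s * f a b) * x $ b) =
          (\<Sum>b<d. (if a = b then of_real (?D a) * x $ b else 0) +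
            of_real (f a b) * of_real s * x $ b)"
        by (intro sum.cong refl) (auto simp: algebra_simps)
      also have "\<dots> = of_real (?D a) * x $ a + (\<Sum>b<d. of_real (f a b) * of_real s * x $ b)"
        using that by (simp add: sum.distrib del: of_real_sum)
      finally show ?thesis by (simp add: distrib_right sum_distrib_right mult.assoc)
    qed
    thus ?thesis by (simp add: sum.distrib del: of_real_sum of_real_add of_real_mult)
  qed
  also have "(\<Sum>a<d. of_real (?D a) * (x $ a * cnj (x $ a))) = ?X"
    by (simp add: sum_distrib_right)
  finally have form: "(signed_laplacian d s f *\<^sub>v x) \<bullet>c x = ?X + ?Y" .
  have "of_real (\<Sum>a<d. \<Sum>b<d. f a b * (cmod (x $ a + of_real s * x $ b))\<^sup>2) =
     (\<Sum>a<d. \<Sum>b<d. of_real (f a b) *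
        ((x $ a + of_real s * x $ b) * cnj (x $ a + of_real s * x $ b)))"
    by (simp only: of_real_sum of_real_mult complex_norm_square)
  also have "\<dots> = (\<Sum>a<d. \<Sum>b<d. of_real (f a b) * (x $ a * cnj (x $ a))
     + of_real (f a b) * (of_real s * (x $ a * cnj (x $ b)))
     + of_real (f a b) * of_real s * (x $ b * cnj (x $ a))
     + of_real (f a b) * (x $ b * cnj (x $ b)))"
    using s by (intro sum.cong refl) (auto simp: algebra_simps)
  also have "\<dots> = ?X + ?Y + ?Y + ?X"
    using swap[of "\<lambda>a b. of_real s * (x $ b * cnj (x $ a))"] swap[of "\<lambda>a b. x $ a * cnj (x $ a)"]
    by (simp add: sum.distrib mult.assoc)
  finally show ?thesis by (simp add: form)
qed

text \<open>Positivity is read off from the quadratic form, a combination of squared moduli with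
  nonnegative weights.\<close>

lemma density_matrix_signed_laplacian:
  assumes sym: "\<And>a b. a < d \<Longrightarrow> b < d \<Longrightarrow> f a b = f b a"
    and nonneg: "\<And>a b. a < d \<Longrightarrow> b < d \<Longrightarrow> 0 \<le> f a b"
    and s: "s = 1 \<or> s = -1" and pos: "signed_laplacian_trace d s f > 0"
  shows "density_matrix d
    (of_real (1 / signed_laplacian_trace d s f) \<cdot>\<^sub>m signed_laplacian d s f)"
proof -
  let ?t = "signed_laplacian_trace d s f"
  let ?L = "signed_laplacian d s f"
  have L: "?L \<in> carrier_mat d d" by (simp add: signed_laplacian_def)
  have "0 \<le> ((of_real (1 / ?t) \<cdot>\<^sub>m ?L) *\<^sub>v x) \<bullet>c x" if x: "x \<in> carrier_vec d" for x
  proof -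
    have "((of_real (1 / ?t) \<cdot>\<^sub>m ?L) *\<^sub>v x) \<bullet>c x = of_real (1 / ?t) * ((?L *\<^sub>v x) \<bullet>c x)"
    proof -
      have "(of_real (1 / ?t) \<cdot>\<^sub>m ?L) *\<^sub>v x = of_real (1 / ?t) \<cdot>\<^sub>v (?L *\<^sub>v x)"
        using x L by (intro eq_vecI) (auto simp: scalar_prod_def sum_distrib_left mult.assoc)
      thus ?thesis using x L by simp
    qed
    also have "\<dots> = of_real (1 / ?t *
        ((\<Sum>a<d. \<Sum>b<d. f a b * (cmod (x $ a + of_real s * x $ b))\<^sup>2) / 2))"
      by (simp only: signed_laplacian_quadratic_form[OF sym s x] of_real_mult)
    also have "0 \<le> \<dots>"
    proof -
      have "0 \<le> 1 / ?t * ((\<Sum>a<d. \<Sum>b<d. f a b * (cmod (x $ a + of_real s * x $ b))\<^sup>2) / 2)"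
        using pos nonneg by (intro mult_nonneg_nonneg divide_nonneg_nonneg sum_nonneg) auto
      thus ?thesis unfolding less_eq_complex_def by simp
    qed
    finally show ?thesis .
  qed
  moreover have "mat_adjoint (of_real (1 / ?t) \<cdot>\<^sub>m ?L) = of_real (1 / ?t) \<cdot>\<^sub>m ?L"
    using L by (intro hermitian_matI[of _ d]) (auto simp: signed_laplacian_def sym)
  moreover have "mat_trace (of_real (1 / ?t) \<cdot>\<^sub>m ?L) = of_real (1 / ?t) * mat_trace ?L"
    using L by (simp add: mat_trace_def sum_distrib_left sum_divide_distrib)
  ultimately show ?thesis
    using pos L by (simp add: density_matrix_def mat_trace_signed_laplacian)
qed

lemma density_matrix_exists:
  assumes "d \<ge> 1"
  shows "\<exists>\<rho>. density_matrix d \<rho>"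
proof -
  \<comment> \<open>A single loop at index 0: its signless Laplacian is twice the projection onto
    the first basis vector, so the trace is 2.\<close>
  let ?f = "\<lambda>a b :: nat. if a = 0 \<and> b = 0 then 1 else 0 :: real"
  have "(\<Sum>a<d. \<Sum>b<d. ?f a b) = (\<Sum>a<d. if a = 0 then 1 else 0)"
    using assms by (intro sum.cong) auto
  hence "signed_laplacian_trace d 1 ?f > 0"
    using assms by (simp add: signed_laplacian_trace_def)
  from density_matrix_signed_laplacian[OF _ _ _ this] show ?thesis by fastforce
qed

text \<open>For \<open>s = -1\<close> the trace can vanish, for instance when all weight sits on
  loops, and normalising is then impossible. The matrix is zero in that case, hence 0 times an
  arbitrary density matrix, so later arguments can treat all signs alike.\<close>

lemma signed_laplacian_multiple_of_density:
  assumes d: "d \<ge> 1" and sym: "\<And>a b. a < d \<Longrightarrow> b < d \<Longrightarrow> f a b = f b a"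
    and nonneg: "\<And>a b. a < d \<Longrightarrow> b < d \<Longrightarrow> 0 \<le> f a b" and s: "s = 1 \<or> s = -1"
  obtains \<rho> where "density_matrix d \<rho>" "0 \<le> signed_laplacian_trace d s f"
    "signed_laplacian d s f = of_real (signed_laplacian_trace d s f) \<cdot>\<^sub>m \<rho>"
proof -
  let ?t = "signed_laplacian_trace d s f"
  have diag: "f a a \<le> (\<Sum>b<d. f a b)" if "a < d" for a
    using that nonneg by (intro member_le_sum) auto
  have summand: "0 \<le> (\<Sum>b<d. f a b) + s * f a a" if "a < d" for a
    using s diag[OF that] nonneg[OF that that] by auto
  have t_sum: "?t = (\<Sum>a<d. (\<Sum>b<d. f a b) + s * f a a)"
    by (simp add: signed_laplacian_trace_def sum.distrib sum_distrib_left)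
  have t: "0 \<le> ?t" unfolding t_sum using summand by (intro sum_nonneg) auto
  show thesis
  proof (cases "?t = 0")
    case True
    \<comment> \<open>A vanishing sum of nonnegative diagonal entries makes each of them
      vanish.\<close>
    have zero: "(\<Sum>b<d. f a b) + s * f a a = 0" if "a < d" for a
      using True summand that unfolding t_sum by (subst (asm) sum_nonneg_eq_0_iff) auto
    have off: "f a b = 0" if "a < d" "b < d" "a \<noteq> b" for a b
    proof -
      \<comment> \<open>Two entries of row \<open>a\<close> are already bounded by the row sum,
        which equals \<open>- s * f a a\<close>; for either sign this forces \<open>f a b\<close> to
        be 0.\<close>
      have "f a a + f a b = sum (f a) {a, b}" using that by simp
      also have "\<dots> \<le> (\<Sum>c<d. f a c)" using that nonneg by (intro sum_mono2) auto
      finally show ?thesis using zero[OF that(1)] s nonneg[OF that(1,2)] nonneg[OF that(1,1)] by auto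
    qed
    obtain \<rho> where \<rho>: "density_matrix d \<rho>" using density_matrix_exists d by blast
    have "signed_laplacian d s f = of_real ?t \<cdot>\<^sub>m \<rho>"
      using \<rho> zero off unfolding True
      by (intro eq_matI) (auto simp: signed_laplacian_def density_matrix_def simp del: of_real_add)
    with \<rho> t that show ?thesis by blast
  next
    case False
    hence "?t > 0" using t by simp
    moreover have "signed_laplacian d s f =
        of_real ?t \<cdot>\<^sub>m (of_real (1 / ?t) \<cdot>\<^sub>m signed_laplacian d s f)"
      using False by (intro eq_matI) auto
    ultimately show ?thesis
      using density_matrix_signed_laplacian[of d f, OF sym nonneg s] t by (intro that) auto
  qed
qed

section \<open>Kronecker products\<close>

lemma sum_div_mod:
  fixes g :: "nat \<Rightarrow> nat \<Rightarrow> 'a :: comm_monoid_add"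
  shows "(\<Sum>a<m * r. g (a div r) (a mod r)) = (\<Sum>i<m. \<Sum>j<r. g i j)"
proof -
  have "(\<Sum>a\<in>{i * r..<i * r + r}. g (a div r) (a mod r)) =
      (\<Sum>j<r. g ((i * r + j) div r) ((i * r + j) mod r))" for i
    by (rule sum.reindex_bij_witness[of _ "\<lambda>j. i * r + j" "\<lambda>a. a - i * r"]) auto
  hence "(\<Sum>a\<in>{i * r..<i * r + r}. g (a div r) (a mod r)) = (\<Sum>j<r. g i j)" for i
    by simp
  thus ?thesis by (simp add: sum.nat_group[symmetric])
qed

text \<open>The three quotients and remainders are the zero-based tensor coordinates of the index
  \<open>a\<close>. Applied to rows and to diagonals, this makes row sums, total weights and
  diagonal sums multiplicative.\<close>

lemma sum_tensor:
  fixes f g h :: "nat \<Rightarrow> 'a :: comm_semiring_0"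
  shows "(\<Sum>a<m * n * q. f (a div q div n) * g (a div q mod n) * h (a mod q)) =
    (\<Sum>i<m. f i) * (\<Sum>j<n. g j) * (\<Sum>k<q. h k)"
proof -
  have "(\<Sum>a<m * n * q. f (a div q div n) * g (a div q mod n) * h (a mod q)) =
      (\<Sum>x<m * n. \<Sum>k<q. f (x div n) * g (x mod n) * h k)"
    by (rule sum_div_mod[of "\<lambda>x k. f (x div n) * g (x mod n) * h k"])
  also have "\<dots> = (\<Sum>x<m * n. f (x div n) * g (x mod n)) * (\<Sum>k<q. h k)"
    by (simp add: sum_product)
  also have "(\<Sum>x<m * n. f (x div n) * g (x mod n)) = (\<Sum>i<m. \<Sum>j<n. f i * g j)"
    by (rule sum_div_mod[of "\<lambda>i j. f i * g j"])
  finally show ?thesis by (simp add: sum_product)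
qed

lemma tensor_index_bounds:
  fixes a :: nat
  assumes "a < m * n * q"
  shows "a div q div n < m" "a div q mod n < n" "a mod q < q"
proof -
  have "0 < n" "0 < q" using assms by (auto intro: gr0I)
  moreover have "a div q < m * n" using assms by (simp add: less_mult_imp_div_less)
  ultimately show "a div q div n < m" "a div q mod n < n" "a mod q < q"
    by (simp_all add: less_mult_imp_div_less)
qed

lemma tensor_index_eq_iff:
  fixes a b :: nat
  shows "a = b \<longleftrightarrow>
    a div q div n = b div q div n \<and> a div q mod n = b div q mod n \<and> a mod q = b mod q"
  by (metis div_mult_mod_eq)

lemma kronecker3_index:
  assumes "A \<in> carrier_mat m m" "B \<in> carrier_mat n n" "C \<in> carrier_mat q q"
    and a: "a < m * n * q" and b: "b < m * n * q"
  shows "(A \<otimes>\<^sub>K B \<otimes>\<^sub>K C) $$ (a, b) =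
    A $$ (a div q div n, b div q div n) * B $$ (a div q mod n, b div q mod n) *
    C $$ (a mod q, b mod q)"
  using assms less_mult_imp_div_less[OF a] less_mult_imp_div_less[OF b]
  by (simp add: kronecker_def)

text \<open>The pair of signs runs through all four combinations, and the third sign is their
  product. Every mixed monomial carries \<open>s1\<close>, \<open>s2\<close> or
  \<open>s1 * s2\<close>, each of which sums to 0, while \<open>x * y * z\<close> and
  \<open>u * v * w\<close> carry the sign 1.\<close>

lemma sum_sign_patterns:
  fixes x y z u v w :: "'a :: comm_ring_1"
  defines "s1 \<equiv> \<lambda>i :: nat. if i < 2 then 1 else - 1 :: 'a"
    and "s2 \<equiv> \<lambda>i :: nat. if even i then 1 else - 1 :: 'a"
  shows "(\<Sum>i<4. (x + s1 i * u) * (y + s2 i * v) * (z + s1 i * s2 i * w)) =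
    4 * (x * y * z + u * v * w)"
proof -
  have "{..<4 :: nat} = {0, 1, 2, 3}" by auto
  thus ?thesis unfolding s1_def s2_def by (simp add: algebra_simps)
qed

text \<open>The state is a mixture of four product states, one for each sign pattern.
  \<open>sum_sign_patterns\<close> is used twice: on traces, to see that the weights sum to 1, and
  on matrix entries, to see that the mixture is the given matrix.\<close>

lemma fully_separable_tensor_laplacian:
  fixes f g h F :: "nat \<Rightarrow> nat \<Rightarrow> real" and m n q :: nat
  defines "T \<equiv> signed_laplacian_trace (m * n * q) 1 F"
  assumes mnq: "m \<ge> 1" "n \<ge> 1" "q \<ge> 1"
    and f: "\<And>a b. a < m \<Longrightarrow> b < m \<Longrightarrow> f a b = f b a"
      "\<And>a b. a < m \<Longrightarrow> b < m \<Longrightarrow> 0 \<le> f a b"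
    and g: "\<And>a b. a < n \<Longrightarrow> b < n \<Longrightarrow> g a b = g b a"
      "\<And>a b. a < n \<Longrightarrow> b < n \<Longrightarrow> 0 \<le> g a b"
    and h: "\<And>a b. a < q \<Longrightarrow> b < q \<Longrightarrow> h a b = h b a"
      "\<And>a b. a < q \<Longrightarrow> b < q \<Longrightarrow> 0 \<le> h a b"
    and F: "\<And>a b. a < m * n * q \<Longrightarrow> b < m * n * q \<Longrightarrow> F a b =
      f (a div q div n) (b div q div n) * g (a div q mod n) (b div q mod n) * h (a mod q) (b mod q)"
    and T: "T > 0"
  shows "fully_separable m n q (of_real (1 / T) \<cdot>\<^sub>m signed_laplacian (m * n * q) 1 F)"
proof -
  let ?N = "m * n * q"
  define s1 where "s1 = (\<lambda>i :: nat. if i < 2 then 1 else - 1 :: real)"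
  define s2 where "s2 = (\<lambda>i :: nat. if even i then 1 else - 1 :: real)"
  have s: "s1 i = 1 \<or> s1 i = -1" "s2 i = 1 \<or> s2 i = -1" "s1 i * s2 i = 1 \<or> s1 i * s2 i = -1" for i
    by (auto simp: s1_def s2_def)
  let ?t1 = "\<lambda>i. signed_laplacian_trace m (s1 i) f"
  let ?t2 = "\<lambda>i. signed_laplacian_trace n (s2 i) g"
  let ?t3 = "\<lambda>i. signed_laplacian_trace q (s1 i * s2 i) h"
  have "\<forall>i. \<exists>\<rho>. density_matrix m \<rho> \<and> 0 \<le> ?t1 i \<and>
      signed_laplacian m (s1 i) f = of_real (?t1 i) \<cdot>\<^sub>m \<rho>"
    using signed_laplacian_multiple_of_density[of m f, OF mnq(1) f s(1)] by metis
  then obtain \<rho>1 where \<rho>1: "\<And>i. density_matrix m (\<rho>1 i)" "\<And>i. 0 \<le> ?t1 i"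
      "\<And>i. signed_laplacian m (s1 i) f = of_real (?t1 i) \<cdot>\<^sub>m \<rho>1 i"
    by metis
  have "\<forall>i. \<exists>\<rho>. density_matrix n \<rho> \<and> 0 \<le> ?t2 i \<and>
      signed_laplacian n (s2 i) g = of_real (?t2 i) \<cdot>\<^sub>m \<rho>"
    using signed_laplacian_multiple_of_density[of n g, OF mnq(2) g s(2)] by metis
  then obtain \<rho>2 where \<rho>2: "\<And>i. density_matrix n (\<rho>2 i)" "\<And>i. 0 \<le> ?t2 i"
      "\<And>i. signed_laplacian n (s2 i) g = of_real (?t2 i) \<cdot>\<^sub>m \<rho>2 i"
    by metis
  have "\<forall>i. \<exists>\<rho>. density_matrix q \<rho> \<and> 0 \<le> ?t3 i \<and>
      signed_laplacian q (s1 i * s2 i) h = of_real (?t3 i) \<cdot>\<^sub>m \<rho>"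
    using signed_laplacian_multiple_of_density[of q h, OF mnq(3) h s(3)] by metis
  then obtain \<rho>3 where \<rho>3: "\<And>i. density_matrix q (\<rho>3 i)" "\<And>i. 0 \<le> ?t3 i"
      "\<And>i. signed_laplacian q (s1 i * s2 i) h = of_real (?t3 i) \<cdot>\<^sub>m \<rho>3 i"
    by metis
  have dims: "\<rho>1 i \<in> carrier_mat m m" "\<rho>2 i \<in> carrier_mat n n" "\<rho>3 i \<in> carrier_mat q q" for i
    using \<rho>1(1) \<rho>2(1) \<rho>3(1) by (simp_all add: density_matrix_def)
  \<comment> \<open>The product of the three traces is what normalising the factors removes;
    \<open>4 * T\<close> accounts for the four patterns and for the normalisation of the whole
    matrix.\<close>
  let ?p = "\<lambda>i. ?t1 i * ?t2 i * ?t3 i / (4 * T)"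
  have row_sum: "(\<Sum>b<?N. F a b) = (\<Sum>i<m. f (a div q div n) i) *
      (\<Sum>j<n. g (a div q mod n) j) * (\<Sum>k<q. h (a mod q) k)" if "a < ?N" for a
    using that by (subst sum_tensor[symmetric]) (intro sum.cong refl, auto simp: F)
  have T_eq: "T = (\<Sum>a<m. \<Sum>b<m. f a b) * (\<Sum>a<n. \<Sum>b<n. g a b) * (\<Sum>a<q. \<Sum>b<q. h a b)
      + (\<Sum>a<m. f a a) * (\<Sum>a<n. g a a) * (\<Sum>a<q. h a a)"
    unfolding T_def signed_laplacian_trace_def sum_tensor[symmetric]
    by (simp add: F row_sum)
  have "(\<Sum>i<4. ?t1 i * ?t2 i * ?t3 i) = 4 * T"
    unfolding signed_laplacian_trace_def s1_def s2_def T_eq by (rule sum_sign_patterns)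
  hence p_sum: "(\<Sum>i<4. ?p i) = 1"
    using T by (simp add: sum_divide_distrib[symmetric])
  have entry: "(of_real (1 / T) \<cdot>\<^sub>m signed_laplacian ?N 1 F) $$ (a, b) =
      (\<Sum>i<4. of_real (?p i) * (\<rho>1 i \<otimes>\<^sub>K \<rho>2 i \<otimes>\<^sub>K \<rho>3 i) $$ (a, b))"
    if ab: "a < ?N" "b < ?N" for a b
  proof -
    let ?x = "if a div q div n = b div q div n then \<Sum>c<m. f (a div q div n) c else 0"
    let ?y = "if a div q mod n = b div q mod n then \<Sum>c<n. g (a div q mod n) c else 0"
    let ?z = "if a mod q = b mod q then \<Sum>c<q. h (a mod q) c else 0"
    let ?u = "f (a div q div n) (b div q div n)"
    let ?v = "g (a div q mod n) (b div q mod n)"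
    let ?w = "h (a mod q) (b mod q)"
    note bounds = tensor_index_bounds[OF ab(1)] tensor_index_bounds[OF ab(2)]
    \<comment> \<open>Each trace is multiplied back into its own factor, which restores the signed
      Laplacians even where a trace is 0.\<close>
    have k: "of_real (?t1 i * ?t2 i * ?t3 i) * (\<rho>1 i \<otimes>\<^sub>K \<rho>2 i \<otimes>\<^sub>K \<rho>3 i) $$ (a, b) =
        of_real ((?x + s1 i * ?u) * (?y + s2 i * ?v) * (?z + s1 i * s2 i * ?w))" for i
    proof -
      have "of_real (?t1 i * ?t2 i * ?t3 i) * (\<rho>1 i \<otimes>\<^sub>K \<rho>2 i \<otimes>\<^sub>K \<rho>3 i) $$ (a, b) =
          (of_real (?t1 i) \<cdot>\<^sub>m \<rho>1 i) $$ (a div q div n, b div q div n) *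
          (of_real (?t2 i) \<cdot>\<^sub>m \<rho>2 i) $$ (a div q mod n, b div q mod n) *
          (of_real (?t3 i) \<cdot>\<^sub>m \<rho>3 i) $$ (a mod q, b mod q)"
        using bounds dims[of i] by (simp add: kronecker3_index[OF dims ab])
      also have "\<dots> = of_real ((?x + s1 i * ?u) * (?y + s2 i * ?v) * (?z + s1 i * s2 i * ?w))"
        unfolding \<rho>1(3)[symmetric] \<rho>2(3)[symmetric] \<rho>3(3)[symmetric]
        using bounds by (simp add: signed_laplacian_def)
      finally show ?thesis .
    qed
    \<comment> \<open>Two indices agree exactly when all three coordinates do, so the diagonal
      matrix of row sums of \<open>F\<close> is the tensor product of the diagonal matrices of the
      factors.\<close>
    have "(if a = b then \<Sum>c<?N. F a c else 0) + 1 * F a b = ?x * ?y * ?z + ?u * ?v * ?w"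
      unfolding row_sum[OF ab(1)] F[OF ab] by (subst tensor_index_eq_iff[of a b q n]) auto
    moreover have "signed_laplacian ?N 1 F $$ (a, b) =
        of_real ((if a = b then \<Sum>c<?N. F a c else 0) + 1 * F a b)"
      using ab by (simp add: signed_laplacian_def)
    moreover have "(\<Sum>i<4. (?x + s1 i * ?u) * (?y + s2 i * ?v) * (?z + s1 i * s2 i * ?w)) =
        4 * (?x * ?y * ?z + ?u * ?v * ?w)"
      unfolding s1_def s2_def by (rule sum_sign_patterns)
    ultimately have "(\<Sum>i<4. of_real (?t1 i * ?t2 i * ?t3 i) * (\<rho>1 i \<otimes>\<^sub>K \<rho>2 i \<otimes>\<^sub>K \<rho>3 i) $$ (a, b)) =
        4 * signed_laplacian ?N 1 F $$ (a, b)"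
      unfolding k of_real_sum[symmetric] by (simp only: of_real_mult of_real_numeral)
    moreover have "of_real (?p i) * (\<rho>1 i \<otimes>\<^sub>K \<rho>2 i \<otimes>\<^sub>K \<rho>3 i) $$ (a, b) =
       of_real (1 / (4 * T)) *
       (of_real (?t1 i * ?t2 i * ?t3 i) * (\<rho>1 i \<otimes>\<^sub>K \<rho>2 i \<otimes>\<^sub>K \<rho>3 i) $$ (a, b))" for i
      by simp
    ultimately have "(\<Sum>i<4. of_real (?p i) * (\<rho>1 i \<otimes>\<^sub>K \<rho>2 i \<otimes>\<^sub>K \<rho>3 i) $$ (a, b)) =
        of_real (1 / (4 * T)) * (4 * signed_laplacian ?N 1 F $$ (a, b))"
      by (simp only: sum_distrib_left[symmetric])
    moreover have "signed_laplacian ?N 1 F \<in> carrier_mat ?N ?N"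
      by (simp add: signed_laplacian_def)
    ultimately show ?thesis
      using ab T by simp
  qed
  have "density_matrix ?N (of_real (1 / T) \<cdot>\<^sub>m signed_laplacian ?N 1 F)"
    unfolding T_def
  proof (rule density_matrix_signed_laplacian)
    show "F a b = F b a" "0 \<le> F a b" if "a < ?N" "b < ?N" for a b
      using tensor_index_bounds[OF that(1)] tensor_index_bounds[OF that(2)] f g h
      by (simp_all add: F that)
  qed (use T in \<open>simp_all add: T_def\<close>)
  moreover have "of_real (1 / T) \<cdot>\<^sub>m signed_laplacian ?N 1 F =
      mat ?N ?N (\<lambda>ab. \<Sum>i<4. of_real (?p i) * (\<rho>1 i \<otimes>\<^sub>K \<rho>2 i \<otimes>\<^sub>K \<rho>3 i) $$ ab)"
    using entry by (intro eq_matI) (auto simp: signed_laplacian_def)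
  moreover have p_nonneg: "0 \<le> ?p i" for i
    using \<rho>1(2)[of i] \<rho>2(2)[of i] \<rho>3(2)[of i] T by simp
  ultimately show ?thesis
    unfolding fully_separable_def
    by (intro conjI exI[of _ "4 :: nat"] exI[of _ ?p] exI[of _ \<rho>1] exI[of _ \<rho>2] exI[of _ \<rho>3] allI impI)
      (assumption | rule p_sum p_nonneg \<rho>1(1) \<rho>2(1) \<rho>3(1))+
qed

section \<open>Factoring a symmetric relation into blocks\<close>

text \<open>All nonzero \<open>r\<close> by \<open>r\<close> blocks share one pattern
  \<open>C\<close>, and \<open>P\<close> records which blocks are nonzero. \<open>C\<close> is
  symmetric because the transpose of a nonzero block is again a nonzero block of \<open>F\<close>,
  hence has the same pattern.\<close>

lemma symmetric_relation_block_factorization: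
  fixes F :: "nat \<Rightarrow> nat \<Rightarrow> bool" and m r :: nat
  assumes sym: "symp F" and bound: "\<And>a b. F a b \<Longrightarrow> a < m * r" and F0: "F a0 b0"
    and blocks: "\<And>a b a' b' x y. \<lbrakk>F a b; F a' b'; x < r; y < r\<rbrakk> \<Longrightarrow>
      F (a div r * r + x) (b div r * r + y) \<longleftrightarrow> F (a' div r * r + x) (b' div r * r + y)"
  obtains P C c c' where "symp P" "symp C"
    "\<And>i j. P i j \<Longrightarrow> i < m" "\<And>x y. C x y \<Longrightarrow> x < r" "C c c'"
    "\<And>a b. F a b \<longleftrightarrow> P (a div r) (b div r) \<and> C (a mod r) (b mod r)"
proof -
  have r: "r > 0" using bound[OF F0] by (auto intro: gr0I)
  define C where "C = (\<lambda>x y. x < r \<and> y < r \<and> F (a0 div r * r + x) (b0 div r * r + y))"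
  \<comment> \<open>One position suffices to detect a nonzero block: the common pattern holds at the
    position of \<open>(a0, b0)\<close> inside its block.\<close>
  define P where "P = (\<lambda>i j. F (i * r + a0 mod r) (j * r + b0 mod r))"
  have fact: "F a b \<longleftrightarrow> P (a div r) (b div r) \<and> C (a mod r) (b mod r)" for a b
  proof
    assume Fab: "F a b"
    show "P (a div r) (b div r) \<and> C (a mod r) (b mod r)"
      using blocks[OF Fab F0, of "a0 mod r" "b0 mod r"] blocks[OF Fab F0, of "a mod r" "b mod r"]
        r F0 Fab
      by (simp add: P_def C_def)
  next
    assume PC: "P (a div r) (b div r) \<and> C (a mod r) (b mod r)"
    hence "F (a div r * r + a0 mod r) (b div r * r + b0 mod r)" by (simp add: P_def)
    from blocks[OF this F0, of "a mod r" "b mod r"] PC r show "F a b" by (simp add: C_def)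
  qed
  have CC: "C (a0 mod r) (b0 mod r)" using F0 r by (simp add: C_def)
  have symP: "symp P"
  proof (rule sympI)
    fix i j assume "P i j"
    hence "F (j * r + b0 mod r) (i * r + a0 mod r)" using sympD[OF sym] by (simp add: P_def)
    thus "P j i" using fact[of "j * r + b0 mod r" "i * r + a0 mod r"] r by simp
  qed
  have symC: "symp C"
  proof (rule sympI)
    fix x y assume C: "C x y"
    hence Fab: "F (b0 div r * r + y) (a0 div r * r + x)" using sympD[OF sym] by (simp add: C_def)
    from blocks[OF Fab F0, of y x] show "C y x" using C Fab by (simp add: C_def)
  qed
  have P_bound: "i < m" if "P i j" for i j
  proof -
    have "i * r + a0 mod r < m * r" using that bound by (simp add: P_def)
    hence "i * r < m * r" by linarith
    thus ?thesis by simp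
  qed
  show thesis
    by (rule that[OF symP symC P_bound _ CC fact]) (simp_all add: C_def)
qed

section \<open>Blocks of the adjacency matrix\<close>

lemma submatrix_intervals:
  assumes "l + r \<le> dim_row A" "l' + r' \<le> dim_col A"
  shows "submatrix A {l..<l + r} {l'..<l' + r'} = mat r r' (\<lambda>(x, y). A $$ (l + x, l' + y))"
proof -
  \<comment> \<open>\<open>l + x\<close> is the element of the interval with exactly
    \<open>x\<close> elements below it.\<close>
  have pick: "pick {l..<l + r} x = l + x" if "x < r" for l r x
  proof -
    have "{a \<in> {l..<l + r}. a < l + x} = {l..<l + x}" using that by auto
    thus ?thesis using pick_card_in_set[of "l + x" "{l..<l + r}"] that by simp
  qed
  have "{i. i < dim_row A \<and> i \<in> {l..<l + r}} = {l..<l + r}"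
    "{i. i < dim_col A \<and> i \<in> {l'..<l' + r'}} = {l'..<l' + r'}"
    using assms by auto
  thus ?thesis by (intro eq_matI) (auto simp: submatrix_def pick)
qed

lemma adjacency_block_eq_mat:
  assumes "(\<lambda>v. v - 1) ` V = {l..<l + r}" "(\<lambda>v. v - 1) ` W = {l'..<l' + r}"
    and "l + r \<le> card (pverts G)" "l' + r \<le> card (pverts G)"
  shows "adjacency_block G V W =
    mat r r (\<lambda>(x, y). of_bool ((l + x + 1, l' + y + 1) \<in> parcs G))"
  unfolding adjacency_block_def assms(1,2) using assms(3,4)
  by (subst submatrix_intervals) (auto simp: adjacency_mat_def intro!: eq_matI)

text \<open>With successors as arguments the truncated subtractions in \<open>vtx\<close>
  disappear.\<close>

lemma vtx_Suc: "vtx n q (Suc i) (Suc j) (Suc k) = Suc ((i * n + j) * q + k)"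
  by (simp add: vtx_def algebra_simps)

lemma Suc_eq_vtx:
  "Suc a = vtx n q (Suc (a div q div n)) (Suc (a div q mod n)) (Suc (a mod q))"
  by (simp add: vtx_Suc)

lemma pred_image_sublayer:
  "(\<lambda>v. v - 1) ` sublayer n q (Suc i) (Suc j) = {(i * n + j) * q..<(i * n + j) * q + q}"
proof -
  have "sublayer n q (Suc i) (Suc j) = (\<lambda>k. vtx n q (Suc i) (Suc j) (Suc k)) ` {0..<q}"
    by (auto simp: sublayer_def image_def Bex_def gr0_conv_Suc Suc_le_eq)
  thus ?thesis
    by (simp add: image_image vtx_Suc image_add_atLeastLessThan add.commute)
qed

text \<open>The \<open>n\<close> sublayers of a layer occupy consecutive intervals of length
  \<open>q\<close>, which join to one interval of length \<open>n * q\<close>.\<close>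

lemma pred_image_layer:
  "(\<lambda>v. v - 1) ` layer n q (Suc i) = {i * (n * q)..<i * (n * q) + n * q}"
proof -
  have "layer n q (Suc i) = (\<Union>j<n. sublayer n q (Suc i) (Suc j))"
    by (fastforce simp: layer_def sublayer_def gr0_conv_Suc Suc_le_eq)
  hence "(\<lambda>v. v - 1) ` layer n q (Suc i) = (\<Union>j<n. {(i * n + j) * q..<(i * n + j) * q + q})"
    by (simp only: image_UN pred_image_sublayer)
  also have "\<dots> = (\<lambda>z. i * (n * q) + z) ` (\<Union>j<n. {j * q..<j * q + q})"
    by (simp add: image_UN image_add_atLeastLessThan algebra_simps)
  also have "(\<Union>j<n. {j * q..<j * q + q}) = {0..<n * q}"
  proof (cases "q = 0")
    case False
    show ?thesis
    proof (intro equalityI subsetI)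
      fix z assume "z \<in> (\<Union>j<n. {j * q..<j * q + q})"
      then obtain j where j: "j < n" "z < Suc j * q" by auto
      have "Suc j * q \<le> n * q" using j by (intro mult_le_mono1) simp
      thus "z \<in> {0..<n * q}" using j by simp
    next
      fix z assume "z \<in> {0..<n * q}"
      hence "z div q < n" by (simp add: less_mult_imp_div_less)
      moreover have "z = z div q * q + z mod q" "z mod q < q" using False by simp_all
      ultimately show "z \<in> (\<Union>j<n. {j * q..<j * q + q})"
        by (intro UN_I[of "z div q"]) (simp, metis atLeastLessThan_iff le_add1 nat_add_left_cancel_less)
    qed
  qed simp
  finally show ?thesis by (simp add: image_add_atLeastLessThan add.commute)
qed

text \<open>The degree of a vertex is the row sum of the adjacency relation: labels start at 1, so
  every neighbour has the form \<open>Suc b\<close> with \<open>b < N\<close>.\<close>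

lemma signless_laplacian_eq_signed_laplacian:
  assumes G: "pair_graph G" and N: "pverts G = {1..N}"
  shows "signless_laplacian G =
    signed_laplacian N 1 (\<lambda>a b. of_bool ((Suc a, Suc b) \<in> parcs G))"
proof -
  interpret pair_graph G by fact
  have deg: "out_degree (with_proj G) (Suc a) = card {b. b < N \<and> (Suc a, Suc b) \<in> parcs G}" for a
  proof -
    have "out_arcs (with_proj G) (Suc a) = (\<lambda>b. (Suc a, Suc b)) ` {b. b < N \<and> (Suc a, Suc b) \<in> parcs G}"
    proof (intro equalityI subsetI)
      fix e assume "e \<in> out_arcs (with_proj G) (Suc a)"
      then obtain w where w: "e = (Suc a, w)" "(Suc a, w) \<in> parcs G"
        by (cases e) (auto simp: out_arcs_def)
      have "w \<in> {1..N}" using arc_snd_in_verts[OF w(2)] N by simp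
      then obtain b where "w = Suc b" "b < N" by (cases w) auto
      thus "e \<in> (\<lambda>b. (Suc a, Suc b)) ` {b. b < N \<and> (Suc a, Suc b) \<in> parcs G}" using w by auto
    qed (auto simp: out_arcs_def)
    thus ?thesis by (simp add: out_degree_def card_image inj_on_def)
  qed
  have "(\<Sum>b<N. of_bool ((Suc a, Suc b) \<in> parcs G)) = (of_nat (out_degree (with_proj G) (Suc a)) :: real)" for a
    by (simp add: deg sum.If_cases of_bool_def Int_def)
  thus ?thesis
    by (intro eq_matI)
      (auto simp: signless_laplacian_def degree_mat_def adjacency_mat_def signed_laplacian_def mat_diag_def N)
qed

section \<open>From the conditions on the graph to the threefold tensor factorization\<close>

theorem theorem3:
  fixes m n q :: nat and G :: "nat pair_pre_digraph"
  assumes "m \<ge> 1" and "n \<ge> 1" and "q \<ge> 1"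
    and "pair_graph G" and "pverts G = {1..m * n * q}" and "parcs G \<noteq> {}"
    and "partially_symmetric m n q G"
    and no_edge_in_layer:
      "\<forall>i\<in>{1..m}. \<forall>j\<in>{1..n}. \<forall>l\<in>{1..n}. \<forall>k\<in>{1..q}. \<forall>v\<in>{1..q}.
         (vtx n q i j k, vtx n q i l v) \<notin> parcs G"
    and layer_blocks:
      "\<forall>i\<in>{1..m}. \<forall>k\<in>{1..m}. \<forall>j\<in>{1..m}. \<forall>l\<in>{1..m}. i \<noteq> k \<longrightarrow> j \<noteq> l \<longrightarrow>
         adjacency_block G (layer n q i) (layer n q k) \<noteq> 0\<^sub>m (n * q) (n * q) \<longrightarrow>
         adjacency_block G (layer n q j) (layer n q l) \<noteq> 0\<^sub>m (n * q) (n * q) \<longrightarrow>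
         adjacency_block G (layer n q i) (layer n q k) = adjacency_block G (layer n q j) (layer n q l)"
    and sublayer_blocks:
      "\<forall>i\<in>{1..m}. \<forall>j\<in>{1..n}. \<forall>k\<in>{1..m}. \<forall>l\<in>{1..n}.
       \<forall>s\<in>{1..m}. \<forall>t\<in>{1..n}. \<forall>u\<in>{1..m}. \<forall>v\<in>{1..n}. (i, j) \<noteq> (k, l) \<longrightarrow> (s, t) \<noteq> (u, v) \<longrightarrow>
         adjacency_block G (sublayer n q i j) (sublayer n q k l) \<noteq> 0\<^sub>m q q \<longrightarrow>
         adjacency_block G (sublayer n q s t) (sublayer n q u v) \<noteq> 0\<^sub>m q q \<longrightarrow>
         adjacency_block G (sublayer n q i j) (sublayer n q k l) =
         adjacency_block G (sublayer n q s t) (sublayer n q u v)"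
    and layer_degrees:
      "\<forall>i\<in>{1..m}. \<forall>v\<in>layer n q i. \<forall>w\<in>layer n q i.
         out_degree (with_proj G) v = out_degree (with_proj G) w"
  shows "fully_separable m n q (rho_q G)"
proof -
  interpret pair_graph G by fact
  let ?N = "m * n * q"
  define F where "F = (\<lambda>a b. (Suc a, Suc b) \<in> parcs G)"
  have symF: "symp F"
    using pair_sym_arcs unfolding F_def symmetric_def by (auto intro: sympI dest: symD)
  have bound: "a < ?N" "b < ?N" if "F a b" for a b
    using arc_fst_in_verts[OF that[unfolded F_def]] arc_snd_in_verts[OF that[unfolded F_def]]
      \<open>pverts G = _\<close> by simp_all
  have in_block: "i * r + r \<le> k * r" if "i < k" for i r k :: nat
    using mult_le_mono1[of "Suc i" k r] that by simp
  \<comment> \<open>The ends of an arc lie in different layers, hence also in different sublayers,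
    so both block conditions apply to the blocks containing arcs.\<close>
  have distinct: "a div q div n \<noteq> b div q div n" if "F a b" for a b
  proof
    assume eq: "a div q div n = b div q div n"
    have "(Suc a, Suc b) \<notin> parcs G"
      unfolding Suc_eq_vtx[of a n q] Suc_eq_vtx[of b n q] eq[symmetric]
      using tensor_index_bounds[OF bound(1)[OF that]]
        tensor_index_bounds[OF bound(2)[OF that]]
      by (intro no_edge_in_layer[rule_format]) (simp_all add: Suc_le_eq)
    thus False using that by (simp add: F_def)
  qed
  \<comment> \<open>The arcs \<open>(a, b)\<close> and \<open>(a', b')\<close> certify that their
    blocks are nonzero; equality of the blocks is then read off at the entry
    \<open>(x, y)\<close>.\<close>
  have layers: "F (a div q div n * (n * q) + x) (b div q div n * (n * q) + y) \<longleftrightarrow>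
      F (a' div q div n * (n * q) + x) (b' div q div n * (n * q) + y)"
    if ab: "F a b" and ab': "F a' b'" and xy: "x < n * q" "y < n * q" for a b a' b' x y
  proof -
    let ?L = "\<lambda>a. layer n q (Suc (a div q div n))"
    let ?s = "\<lambda>a. a div q div n * (n * q)"
    have block: "adjacency_block G (?L a) (?L b) =
        mat (n * q) (n * q) (\<lambda>(x, y). of_bool (F (?s a + x) (?s b + y)))"
      if "a < ?N" "b < ?N" for a b
      using that tensor_index_bounds(1)[of a m n q] tensor_index_bounds(1)[of b m n q]
        in_block[of _ m "n * q"] \<open>pverts G = _\<close>
      by (subst adjacency_block_eq_mat[OF pred_image_layer pred_image_layer])
        (auto simp: F_def mult.assoc)
    have nonzero: "adjacency_block G (?L a) (?L b) \<noteq> 0\<^sub>m (n * q) (n * q)" if "F a b" for a b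
    proof -
      have "a mod (n * q) < n * q" "b mod (n * q) < n * q" using assms(2,3) by simp_all
      moreover have "?s a + a mod (n * q) = a" "?s b + b mod (n * q) = b"
        unfolding div_mult2_eq[symmetric] mult.commute[of q n] by (rule div_mult_mod_eq)+
      ultimately have "adjacency_block G (?L a) (?L b) $$ (a mod (n * q), b mod (n * q)) = 1"
        using that bound by (simp add: block)
      thus ?thesis
        using \<open>a mod (n * q) < n * q\<close> \<open>b mod (n * q) < n * q\<close> by auto
    qed
    have "adjacency_block G (?L a) (?L b) = adjacency_block G (?L a') (?L b')"
      using bound[OF ab] bound[OF ab'] distinct[OF ab] distinct[OF ab'] nonzero[OF ab] nonzero[OF ab']
        tensor_index_bounds(1)[of _ m n q]
      by (intro layer_blocks[rule_format]) (auto simp: Suc_le_eq)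
    hence "adjacency_block G (?L a) (?L b) $$ (x, y) = adjacency_block G (?L a') (?L b') $$ (x, y)"
      by simp
    thus ?thesis using xy bound[OF ab] bound[OF ab'] by (simp add: block of_bool_eq_iff)
  qed
  have sublayers: "F (a div q * q + x) (b div q * q + y) \<longleftrightarrow>
      F (a' div q * q + x) (b' div q * q + y)"
    if ab: "F a b" and ab': "F a' b'" and xy: "x < q" "y < q" for a b a' b' x y
  proof -
    let ?L = "\<lambda>a. sublayer n q (Suc (a div q div n)) (Suc (a div q mod n))"
    have block: "adjacency_block G (?L a) (?L b) =
        mat q q (\<lambda>(x, y). of_bool (F (a div q * q + x) (b div q * q + y)))"
      if "a < ?N" "b < ?N" for a b
      using that less_mult_imp_div_less[of _ "m * n" q] in_block[of _ "m * n" q] \<open>pverts G = _\<close>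
      by (subst adjacency_block_eq_mat[OF pred_image_sublayer pred_image_sublayer])
        (auto simp: F_def)
    have nonzero: "adjacency_block G (?L a) (?L b) \<noteq> 0\<^sub>m q q" if "F a b" for a b
    proof -
      have "a mod q < q" "b mod q < q" using assms(3) by simp_all
      moreover from this have "adjacency_block G (?L a) (?L b) $$ (a mod q, b mod q) = 1"
        using that bound by (simp add: block)
      ultimately show ?thesis by auto
    qed
    have "adjacency_block G (?L a) (?L b) = adjacency_block G (?L a') (?L b')"
      using bound[OF ab] bound[OF ab'] distinct[OF ab] distinct[OF ab'] nonzero[OF ab] nonzero[OF ab']
        tensor_index_bounds(1,2)[of _ m n q]
      by (intro sublayer_blocks[rule_format]) (auto simp: Suc_le_eq)
    hence "adjacency_block G (?L a) (?L b) $$ (x, y) = adjacency_block G (?L a') (?L b') $$ (x, y)"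
      by simp
    thus ?thesis using xy bound[OF ab] bound[OF ab'] by (simp add: block of_bool_eq_iff)
  qed
  obtain a0 b0 where ab0: "F a0 b0"
  proof -
    obtain v w where vw: "(v, w) \<in> parcs G" using \<open>parcs G \<noteq> {}\<close> by auto
    have "v \<in> {1..?N}" "w \<in> {1..?N}"
      using arc_fst_in_verts[OF vw] arc_snd_in_verts[OF vw] \<open>pverts G = _\<close> by auto
    hence "F (v - 1) (w - 1)" using vw by (simp add: F_def)
    thus thesis by (rule that)
  qed
  \<comment> \<open>The first factorization splits off the last coordinate; \<open>P\<close> relates
    sublayers.\<close>
  obtain P C c c' where P: "symp P" and C: "symp C" and P_bound: "\<And>i j. P i j \<Longrightarrow> i < m * n"
    and C_bound: "\<And>x y. C x y \<Longrightarrow> x < q" and c: "C c c'"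
    and FPC: "\<And>a b. F a b \<longleftrightarrow> P (a div q) (b div q) \<and> C (a mod q) (b mod q)"
  proof (rule symmetric_relation_block_factorization[of F "m * n" q a0 b0])
    show "a < ?N" if "F a b" for a b by (rule bound(1)[OF that])
    show "F (a div q * q + x) (b div q * q + y) \<longleftrightarrow> F (a' div q * q + x) (b' div q * q + y)"
      if "F a b" "F a' b'" "x < q" "y < q" for a b a' b' x y
      by (rule sublayers[OF that])
  qed (rule symF, rule ab0, rule that)
  have cq: "c < q" "c' < q" using C_bound c sympD[OF C c] by auto
  \<comment> \<open>Fixing the position \<open>(c, c')\<close> where \<open>C\<close> holds embeds
    \<open>P\<close> into \<open>F\<close>, which carries the layer condition over to
    \<open>P\<close>.\<close>
  have PF: "P i j \<longleftrightarrow> F (i * q + c) (j * q + c')" for i j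
    using FPC[of "i * q + c" "j * q + c'"] cq c by simp
  have layers': "P (i div n * n + x) (j div n * n + y) \<longleftrightarrow> P (i' div n * n + x) (j' div n * n + y)"
    if ij: "P i j" "P i' j'" and xy: "x < n" "y < n" for i j i' j' x y
  proof -
    have "x * q + c < n * q" "y * q + c' < n * q"
      using in_block[OF xy(1), of q] in_block[OF xy(2), of q] cq by auto
    from layers[OF ij(1)[unfolded PF] ij(2)[unfolded PF] this] show ?thesis
      using cq by (simp add: PF distrib_right add.assoc mult.assoc)
  qed
  obtain M D d d' where M: "symp M" and D: "symp D" and "\<And>i j. M i j \<Longrightarrow> i < m"
    and "\<And>x y. D x y \<Longrightarrow> x < n" and "D d d'"
    and PMD: "\<And>i j. P i j \<longleftrightarrow> M (i div n) (j div n) \<and> D (i mod n) (j mod n)"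
  proof (rule symmetric_relation_block_factorization[of P m n "a0 div q" "b0 div q"])
    show "i < m * n" if "P i j" for i j by (rule P_bound[OF that])
    show "P (a0 div q) (b0 div q)" using FPC ab0 by blast
    show "P (i div n * n + x) (j div n * n + y) \<longleftrightarrow> P (i' div n * n + x) (j' div n * n + y)"
      if "P i j" "P i' j'" "x < n" "y < n" for i j i' j' x y
      by (rule layers'[OF that])
  qed (rule P, rule that)
  let ?T = "signed_laplacian_trace ?N 1 (\<lambda>a b. of_bool (F a b))"
  \<comment> \<open>A single arc already makes the total weight positive, and the diagonal part of
    the trace is nonnegative.\<close>
  have "0 < (of_bool (F a0 b0) :: real)" using ab0 by simp
  also have "\<dots> \<le> (\<Sum>b<?N. of_bool (F a0 b))"
    using bound[OF ab0] by (intro member_le_sum) auto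
  also have "\<dots> \<le> (\<Sum>a<?N. \<Sum>b<?N. of_bool (F a b))"
    using bound[OF ab0] by (intro member_le_sum[where f = "\<lambda>a. \<Sum>b<?N. of_bool (F a b)"]) (auto intro!: sum_nonneg)
  also have "\<dots> \<le> ?T" by (auto simp: signed_laplacian_trace_def intro!: sum_nonneg)
  finally have T: "?T > 0" .
  have "rho_q G = of_real (1 / ?T) \<cdot>\<^sub>m signed_laplacian ?N 1 (\<lambda>a b. of_bool (F a b))"
    unfolding rho_q_def
      signless_laplacian_eq_signed_laplacian[OF \<open>pair_graph G\<close> \<open>pverts G = _\<close>]
      mat_trace_signed_laplacian by (simp add: F_def)
  also have "fully_separable m n q \<dots>"
  proof (rule fully_separable_tensor_laplacian[where f = "\<lambda>a b. of_bool (M a b)" and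
        g = "\<lambda>a b. of_bool (D a b)" and h = "\<lambda>a b. of_bool (C a b)"])
    show "of_bool (F a b) = of_bool (M (a div q div n) (b div q div n)) *
        of_bool (D (a div q mod n) (b div q mod n)) * (of_bool (C (a mod q) (b mod q)) :: real)"
      if "a < ?N" "b < ?N" for a b
      by (simp add: FPC PMD)
    show "of_bool (M a b) = (of_bool (M b a) :: real)" if "a < m" "b < m" for a b
      using sympD[OF M] by (auto simp: of_bool_def)
    show "of_bool (D a b) = (of_bool (D b a) :: real)" if "a < n" "b < n" for a b
      using sympD[OF D] by (auto simp: of_bool_def)
    show "of_bool (C a b) = (of_bool (C b a) :: real)" if "a < q" "b < q" for a b
      using sympD[OF C] by (auto simp: of_bool_def)
  qed (use assms(1-3) T in auto)
  finally show ?thesis .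
qed

end
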